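(* Let $\mathcal{I}$ be a nontrivial admissible ideal on $\mathbb{N}$ satisfying shrinking condition (B), and let $X$ be a topological space whose one point compactification is metrizable. Then the one point $\mathcal{I}$-compactification $\widehat{X}$ of $X$ is homeomorphic to the one point compactification of $X$.
   Context: An ideal $\mathcal{I}$ on $\mathbb{N}$ is a family of subsets of $\mathbb{N}$ containing $\emptyset$ and closed under finite unions and subsets; it is nontrivial if $\mathcal{I}\neq\{\emptyset\}$ and $\mathbb{N}\notin\mathcal{I}$, and a nontrivial ideal is admissible if it contains all singletons. For $M\subset\mathbb{N}$, $\mathcal{I}/_M=\{A\cap M: A\in\mathcal{I}\}$. A sequence $(x_n)_{n\in M}$ in a topological space (a family indexed by $M\subset\mathbb{N}$) is $\mathcal{I}$-nonthin if $M\notin\mathcal{I}$. It $\mathcal{I}/_M$-converges to $x$ if for every open set $U\ni x$, $\{n\in M: x_n\notin U\}\in\mathcal{I}/_M$. Subsequences of $(x_n)_{n\in K}$ are the families $(x_n)_{n\in M}$ with $M\subset K$. A space $X$ is $\mathcal{I}$-compact if every $\mathcal{I}$-nonthin sequence $(x_n)_{n\in K}$ in $X$ has an $\mathcal{I}$-nonthin subsequence $(x_n)_{n\in M}$ that $\mathcal{I}/_M$-converges to some point of $X$; a subset is $\mathcal{I}$-compact if it is so as a subspace. $\mathcal{I}$ satisfies shrinking condition (B) if for any sequence $\{A_i\}$ of sets not in $\mathcal{I}$ there is a sequence $\{B_i\}$ of sets in $\mathcal{I}$ such that $B_i\subset A_i$ for each $i$ and $\bigcup_{i=1}^\infty B_i\notin\mathcal{I}$.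 The one point $\mathcal{I}$-compactification of a space $(X,\tau)$ is the set $\widehat{X}=X\cup\{\alpha\}$, where $\alpha\notin X$ is the point at infinity of $X$, with topology $\widehat{\tau}=\tau\cup\{U\cup\{\alpha\}: U\subset X,\ X-U \text{ is closed and } \mathcal{I}\text{-compact in } X\}$. *)

theory Defs
  imports "HOL-Analysis.Analysis"
begin

definition ideal_on_nat :: "nat set set \<Rightarrow> bool" where
  "ideal_on_nat I \<longleftrightarrow>
     {} \<in> I \<and> (\<forall>A\<in>I. \<forall>B\<in>I. A \<union> B \<in> I) \<and> (\<forall>A\<in>I. \<forall>B. B \<subseteq> A \<longrightarrow> B \<in> I)"

definition nontrivial_ideal :: "nat set set \<Rightarrow> bool" where
  "nontrivial_ideal I \<longleftrightarrow> ideal_on_nat I \<and> I \<noteq> {{}} \<and> UNIV \<notin> I"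

definition admissible_ideal :: "nat set set \<Rightarrow> bool" where
  "admissible_ideal I \<longleftrightarrow> nontrivial_ideal I \<and> (\<forall>n. {n} \<in> I)"

definition ideal_trace :: "nat set set \<Rightarrow> nat set \<Rightarrow> nat set set" where
  "ideal_trace I M = {A \<inter> M |A. A \<in> I}"

definition shrinking_condition_B :: "nat set set \<Rightarrow> bool" where
  "shrinking_condition_B I \<longleftrightarrow>
     (\<forall>A :: nat \<Rightarrow> nat set. (\<forall>i. A i \<notin> I) \<longrightarrow>
        (\<exists>B. (\<forall>i. B i \<in> I \<and> B i \<subseteq> A i) \<and> (\<Union>i. B i) \<notin> I))"

text \<open>A sequence indexed by a set \<open>M\<close> of natural numbers is a function on all of
  \<^typ>\<open>nat\<close> whose values outside \<open>M\<close> are irrelevant, so that its subsequence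
  indexed by a subset of \<open>M\<close> is given by the same function.\<close>

definition trace_converges ::
    "nat set set \<Rightarrow> 'a topology \<Rightarrow> nat set \<Rightarrow> (nat \<Rightarrow> 'a) \<Rightarrow> 'a \<Rightarrow> bool" where
  "trace_converges I X M x l \<longleftrightarrow>
     l \<in> topspace X \<and>
     (\<forall>U. openin X U \<and> l \<in> U \<longrightarrow> {n \<in> M. x n \<notin> U} \<in> ideal_trace I M)"

definition ideal_compact_space :: "nat set set \<Rightarrow> 'a topology \<Rightarrow> bool" where
  "ideal_compact_space I X \<longleftrightarrow>
     (\<forall>K x. K \<notin> I \<and> x \<in> K \<rightarrow> topspace X \<longrightarrow>
        (\<exists>M l. M \<subseteq> K \<and> M \<notin> I \<and> trace_converges I X M x l))"

definition ideal_compactin :: "nat set set \<Rightarrow> 'a topology \<Rightarrow> 'a set \<Rightarrow> bool" where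
  "ideal_compactin I X S \<longleftrightarrow> S \<subseteq> topspace X \<and> ideal_compact_space I (subtopology X S)"

text \<open>As in \<^const>\<open>Alexandroff_compactification\<close>, the point at infinity is \<^const>\<open>None\<close>.\<close>

definition ideal_compactification_open ::
    "nat set set \<Rightarrow> 'a topology \<Rightarrow> 'a option set \<Rightarrow> bool" where
  "ideal_compactification_open I X W \<longleftrightarrow>
     (\<exists>U. openin X U \<and> W = Some ` U) \<or>
     (\<exists>U. U \<subseteq> topspace X \<and> closedin X (topspace X - U) \<and>
          ideal_compactin I X (topspace X - U) \<and> W = insert None (Some ` U))"

definition ideal_compactification :: "nat set set \<Rightarrow> 'a topology \<Rightarrow> 'a option topology" where
  "ideal_compactification I X = topology (ideal_compactification_open I X)"

text \<open>The rest of this theory checks that the family above is a topology for every ideal, so that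
  \<^const>\<open>topology\<close> does not return an unspecified value.\<close>

lemma ideal_trace_iff:
  assumes "ideal_on_nat I" "B \<subseteq> M"
  shows "B \<in> ideal_trace I M \<longleftrightarrow> B \<in> I"
proof
  assume "B \<in> ideal_trace I M"
  then obtain A where "A \<in> I" "B = A \<inter> M"
    by (auto simp: ideal_trace_def)
  then show "B \<in> I"
    using assms(1) unfolding ideal_on_nat_def by (meson inf_le1)
next
  assume "B \<in> I"
  moreover have "B = B \<inter> M"
    using assms(2) by blast
  ultimately show "B \<in> ideal_trace I M"
    unfolding ideal_trace_def by blast
qed

lemma trace_converges_subtopology:
  assumes "x \<in> M \<rightarrow> S"
  shows "trace_converges I (subtopology X S) M x l \<longleftrightarrow> l \<in> S \<and> trace_converges I X M x l"
proof -
  have "{n \<in> M. x n \<notin> U \<inter> S} = {n \<in> M. x n \<notin> U}" for U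
    using assms by auto
  moreover have "(\<forall>U. openin (subtopology X S) U \<and> l \<in> U \<longrightarrow> P U) \<longleftrightarrow>
      (\<forall>T. openin X T \<and> l \<in> T \<and> l \<in> S \<longrightarrow> P (T \<inter> S))" for P
    unfolding openin_subtopology by blast
  ultimately show ?thesis
    unfolding trace_converges_def topspace_subtopology by (simp only:) blast
qed

lemma ideal_compactin_iff:
  "ideal_compactin I X S \<longleftrightarrow> S \<subseteq> topspace X \<and>
     (\<forall>K x. K \<notin> I \<and> x \<in> K \<rightarrow> S \<longrightarrow>
        (\<exists>M l. M \<subseteq> K \<and> M \<notin> I \<and> l \<in> S \<and> trace_converges I X M x l))"
proof (cases "S \<subseteq> topspace X")
  case True
  then have "topspace (subtopology X S) = S"
    by auto
  moreover have "(\<exists>M l. M \<subseteq> K \<and> M \<notin> I \<and> trace_converges I (subtopology X S) M x l) \<longleftrightarrow>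
      (\<exists>M l. M \<subseteq> K \<and> M \<notin> I \<and> l \<in> S \<and> trace_converges I X M x l)"
    if "x \<in> K \<rightarrow> S" for K x
  proof -
    have "trace_converges I (subtopology X S) M x l \<longleftrightarrow> l \<in> S \<and> trace_converges I X M x l"
      if "M \<subseteq> K" for M l
      using \<open>x \<in> K \<rightarrow> S\<close> that by (intro trace_converges_subtopology) auto
    then show ?thesis
      by (simp cong: conj_cong)
  qed
  ultimately show ?thesis
    using True unfolding ideal_compactin_def ideal_compact_space_def
    by (simp cong: conj_cong imp_cong)
qed (simp add: ideal_compactin_def)

lemma ideal_compactin_empty:
  assumes "ideal_on_nat I"
  shows "ideal_compactin I X {}"
proof -
  have "x \<in> K \<rightarrow> {} \<Longrightarrow> K = {}" for K and x :: "nat \<Rightarrow> 'a"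
    by auto
  then show ?thesis
    using assms unfolding ideal_compactin_iff ideal_on_nat_def by blast
qed

lemma closed_ideal_compactin:
  assumes I: "ideal_on_nat I" and C: "ideal_compactin I X C" and D: "closedin X D" "D \<subseteq> C"
  shows "ideal_compactin I X D"
  unfolding ideal_compactin_iff
proof (intro conjI allI impI)
  show "D \<subseteq> topspace X"
    using D(1) closedin_subset by blast
  fix K x assume K: "K \<notin> I \<and> x \<in> K \<rightarrow> D"
  then have "x \<in> K \<rightarrow> C"
    using D(2) by auto
  then obtain M l where M: "M \<subseteq> K" "M \<notin> I" and l: "trace_converges I X M x l"
    using C K unfolding ideal_compactin_iff by meson
  have "l \<in> D"
  proof (rule ccontr)
    assume "l \<notin> D"
    then have "openin X (topspace X - D)" "l \<in> topspace X - D"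
      using D(1) l by (auto simp: trace_converges_def)
    then have "{n \<in> M. x n \<notin> topspace X - D} \<in> ideal_trace I M"
      using l unfolding trace_converges_def by blast
    moreover have "{n \<in> M. x n \<notin> topspace X - D} = M"
      using K M(1) by auto
    ultimately show False
      using M(2) ideal_trace_iff[OF I, of M M] by simp
  qed
  then show "\<exists>M l. M \<subseteq> K \<and> M \<notin> I \<and> l \<in> D \<and> trace_converges I X M x l"
    using M l by blast
qed

lemma ideal_compactin_Un:
  assumes I: "ideal_on_nat I" and C: "ideal_compactin I X C" and D: "ideal_compactin I X D"
  shows "ideal_compactin I X (C \<union> D)"
  unfolding ideal_compactin_iff
proof (intro conjI allI impI)
  show "C \<union> D \<subseteq> topspace X"
    using C D by (simp add: ideal_compactin_def)
  fix K x assume K: "K \<notin> I \<and> x \<in> K \<rightarrow> C \<union> D"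
  define KC KD where "KC = {n \<in> K. x n \<in> C}" and "KD = {n \<in> K. x n \<in> D}"
  have eq: "K = KC \<union> KD" and sub: "KC \<subseteq> K" "KD \<subseteq> K"
    and x: "x \<in> KC \<rightarrow> C" "x \<in> KD \<rightarrow> D"
    using K by (auto simp: KC_def KD_def)
  have "KC \<notin> I \<or> KD \<notin> I"
    using I K eq unfolding ideal_on_nat_def by metis
  then show "\<exists>M l. M \<subseteq> K \<and> M \<notin> I \<and> l \<in> C \<union> D \<and> trace_converges I X M x l"
  proof
    assume "KC \<notin> I"
    then obtain M l where "M \<subseteq> KC" "M \<notin> I" "l \<in> C" "trace_converges I X M x l"
      using C x unfolding ideal_compactin_iff by meson
    then show ?thesis using sub by blast
  next
    assume "KD \<notin> I"
    then obtain M l where "M \<subseteq> KD" "M \<notin> I" "l \<in> D" "trace_converges I X M x l"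
      using D x unfolding ideal_compactin_iff by meson
    then show ?thesis using sub by blast
  qed
qed

lemma ideal_compactification_open_iff:
  "ideal_compactification_open I X W \<longleftrightarrow>
     openin X (Some -` W) \<and>
     (None \<in> W \<longrightarrow> ideal_compactin I X (topspace X - Some -` W))"
proof
  have inj: "Some -` Some ` U = U" "Some -` insert None (Some ` U) = U" for U :: "'a set"
    by auto
  assume "ideal_compactification_open I X W"
  then show "openin X (Some -` W) \<and>
     (None \<in> W \<longrightarrow> ideal_compactin I X (topspace X - Some -` W))"
    unfolding ideal_compactification_open_def
    by (auto simp: inj openin_closedin_eq)
next
  assume R: "openin X (Some -` W) \<and>
     (None \<in> W \<longrightarrow> ideal_compactin I X (topspace X - Some -` W))"
  have W: "W = (if None \<in> W then insert None (Some ` (Some -` W)) else Some ` (Some -` W))"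
  proof (rule set_eqI)
    fix z show "z \<in> W \<longleftrightarrow>
      z \<in> (if None \<in> W then insert None (Some ` (Some -` W)) else Some ` (Some -` W))"
      by (cases z) auto
  qed
  show "ideal_compactification_open I X W"
    unfolding ideal_compactification_open_def
    using R W by (smt (verit) openin_closedin_eq)
qed

lemma istopology_ideal_compactification_open:
  assumes I: "ideal_on_nat I"
  shows "istopology (ideal_compactification_open I X)"
  unfolding istopology_def
proof (intro conjI strip)
  fix S T
  assume "ideal_compactification_open I X S" "ideal_compactification_open I X T"
  then show "ideal_compactification_open I X (S \<inter> T)"
    unfolding ideal_compactification_open_iff
    by (auto simp: Diff_Int intro: ideal_compactin_Un[OF I])
next
  fix \<K>
  assume K: "\<forall>K\<in>\<K>. ideal_compactification_open I X K"
  have op: "openin X (Some -` \<Union>\<K>)"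
    unfolding vimage_Union using K by (auto simp: ideal_compactification_open_iff)
  moreover have "ideal_compactin I X (topspace X - Some -` \<Union>\<K>)" if N: "None \<in> \<Union>\<K>"
  proof -
    obtain W where W: "W \<in> \<K>" "None \<in> W"
      using N by blast
    then have "ideal_compactin I X (topspace X - Some -` W)"
      using K by (auto simp: ideal_compactification_open_iff)
    moreover have "topspace X - Some -` \<Union>\<K> \<subseteq> topspace X - Some -` W"
      using W by auto
    ultimately show ?thesis
      using closed_ideal_compactin[OF I] op by blast
  qed
  ultimately show "ideal_compactification_open I X (\<Union>\<K>)"
    unfolding ideal_compactification_open_iff by blast
qed

lemma openin_ideal_compactification:
  assumes "ideal_on_nat I"
  shows "openin (ideal_compactification I X) W \<longleftrightarrow> ideal_compactification_open I X W"
  by (simp add: assms ideal_compactification_def istopology_ideal_compactification_open)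

lemma topspace_ideal_compactification:
  assumes "ideal_on_nat I"
  shows "topspace (ideal_compactification I X) = insert None (Some ` topspace X)"
proof (rule antisym)
  show "topspace (ideal_compactification I X) \<subseteq> insert None (Some ` topspace X)"
    unfolding topspace_def openin_ideal_compactification[OF assms]
    by (auto simp: ideal_compactification_open_def dest: openin_subset)
  have "ideal_compactification_open I X (insert None (Some ` topspace X))"
    unfolding ideal_compactification_open_def
    by (intro disjI2 exI[of _ "topspace X"]) (simp add: ideal_compactin_empty[OF assms])
  then show "insert None (Some ` topspace X) \<subseteq> topspace (ideal_compactification I X)"
    using openin_ideal_compactification[OF assms] openin_subset by blast
qed

end

theory Submission
  imports Defs
begin

text \<open>Both compactifications have the same open sets as soon as compactness and
  \<open>I\<close>-compactness agree on closed subsets of \<open>X\<close>, and \<open>X\<close> is metrizable as a subspace of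
  its one point compactification. If \<open>S\<close> is compact, every \<open>I\<close>-nonthin sequence in \<open>S\<close> has a
  point all of whose neighbourhoods are visited along a set outside \<open>I\<close>; shrinking condition
  (B) applied to a decreasing neighbourhood base glues these sets to the index set of a convergent
  nonthin subsequence. Conversely, an \<open>I\<close>-limit of a subsequence of an injective sequence is an
  accumulation point of its range, so \<open>I\<close>-compact sets have the Bolzano-Weierstrass property.\<close>

lemma ideal_on_natD:
  assumes "ideal_on_nat I"
  shows ideal_empty: "{} \<in> I"
    and ideal_Un: "\<And>A B. A \<in> I \<Longrightarrow> B \<in> I \<Longrightarrow> A \<union> B \<in> I"
    and ideal_subset: "\<And>A B. A \<in> I \<Longrightarrow> B \<subseteq> A \<Longrightarrow> B \<in> I"
  using assms unfolding ideal_on_nat_def by blast+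

lemma ideal_finite_Union:
  assumes "ideal_on_nat I" "finite F" "\<And>i. i \<in> F \<Longrightarrow> A i \<in> I"
  shows "(\<Union>i\<in>F. A i) \<in> I"
  using assms(2,3)
  by (induction F rule: finite_induct)
     (simp_all add: ideal_empty[OF assms(1)] ideal_Un[OF assms(1)])

lemma admissible_idealD:
  assumes "admissible_ideal I"
  shows "ideal_on_nat I" "UNIV \<notin> I" "\<And>n. {n} \<in> I"
  using assms unfolding admissible_ideal_def nontrivial_ideal_def by blast+

lemma admissible_ideal_finite:
  assumes "admissible_ideal I" "finite A"
  shows "A \<in> I"
  using ideal_finite_Union[of I A "\<lambda>n. {n}"] admissible_idealD[OF assms(1)] assms(2) by simp

text \<open>Exceptional index sets are subsets of \<open>M\<close>, and for these membership in the
  trace is membership in \<open>I\<close>. This removes the trace from all later arguments.\<close>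

lemma trace_converges_iff:
  assumes "ideal_on_nat I"
  shows "trace_converges I X M x l \<longleftrightarrow>
     l \<in> topspace X \<and> (\<forall>U. openin X U \<and> l \<in> U \<longrightarrow> {n \<in> M. x n \<notin> U} \<in> I)"
proof -
  have "{n \<in> M. x n \<notin> U} \<in> ideal_trace I M \<longleftrightarrow> {n \<in> M. x n \<notin> U} \<in> I" for U
    using assms by (intro ideal_trace_iff) auto
  then show ?thesis
    by (simp add: trace_converges_def)
qed

text \<open>Otherwise the open sets that \<open>x\<close> visits along an index set in
  \<open>I\<close> cover \<open>S\<close>. A finite subcover then places \<open>K\<close> inside a
  finite union of members of \<open>I\<close>.\<close>

lemma compactin_ideal_cluster_point:
  assumes I: "ideal_on_nat I" and S: "compactin X S" and K: "K \<notin> I" "x \<in> K \<rightarrow> S"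
  shows "\<exists>l\<in>S. \<forall>U. openin X U \<and> l \<in> U \<longrightarrow> {n \<in> K. x n \<in> U} \<notin> I"
proof (rule ccontr)
  define \<U> where "\<U> = {U. openin X U \<and> {n \<in> K. x n \<in> U} \<in> I}"
  assume "\<not> ?thesis"
  then have "S \<subseteq> \<Union>\<U>"
    unfolding \<U>_def by blast
  moreover have "\<forall>U\<in>\<U>. openin X U"
    by (simp add: \<U>_def)
  ultimately obtain \<F> where F: "finite \<F>" "\<F> \<subseteq> \<U>" "S \<subseteq> \<Union>\<F>"
    using S unfolding compactin_def by meson
  have "(\<Union>U\<in>\<F>. {n \<in> K. x n \<in> U}) \<in> I"
    using F by (intro ideal_finite_Union[OF I]) (auto simp: \<U>_def)
  moreover have "K \<subseteq> (\<Union>U\<in>\<F>. {n \<in> K. x n \<in> U})"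
    using K(2) F(3) by blast
  ultimately show False
    using K(1) ideal_subset[OF I] by blast
qed

lemma first_countable_decreasing_base:
  assumes "first_countable X" "l \<in> topspace X"
  obtains W :: "nat \<Rightarrow> 'a set" where "decseq W" "\<And>i. openin X (W i)" "\<And>i. l \<in> W i"
    "\<And>U. openin X U \<Longrightarrow> l \<in> U \<Longrightarrow> \<exists>i. W i \<subseteq> U"
proof -
  obtain \<B> where B: "countable \<B>" "\<And>V. V \<in> \<B> \<Longrightarrow> openin X V"
    "\<And>U. openin X U \<Longrightarrow> l \<in> U \<Longrightarrow> \<exists>V\<in>\<B>. l \<in> V \<and> V \<subseteq> U"
    using assms unfolding first_countable_def by metis
  \<comment> \<open>Members of \<open>\<B>\<close> may miss \<open>l\<close>; those containing it
    still form a base at \<open>l\<close>. Being nonempty and countable, they are the range of a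
    sequence.\<close>
  define \<C> where "\<C> = {V \<in> \<B>. l \<in> V}"
  have ne: "\<C> \<noteq> {}"
    using B(3)[OF openin_topspace assms(2)] by (auto simp: \<C>_def)
  have "countable \<C>"
    using B(1) by (simp add: \<C>_def)
  define V where "V = from_nat_into \<C>"
  have V: "range V = \<C>"
    unfolding V_def using ne \<open>countable \<C>\<close> by (rule range_from_nat_into)
  \<comment> \<open>Finite intersections keep the sets open and make the base decreasing.\<close>
  define W where "W i = (\<Inter>j\<le>i. V j)" for i
  show thesis
  proof
    show "decseq W"
      by (force simp: W_def decseq_def)
    show "openin X (W i)" for i
      unfolding W_def using V B(2) by (intro openin_Inter) (auto simp: \<C>_def)
    show "l \<in> W i" for i
      using V by (auto simp: W_def \<C>_def)
    show "\<exists>i. W i \<subseteq> U" if U: "openin X U" "l \<in> U" for U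
    proof -
      obtain V' where "V' \<in> \<C>" "V' \<subseteq> U"
        using B(3)[OF U] by (auto simp: \<C>_def)
      then obtain i where "V i \<subseteq> U"
        using V by blast
      then show ?thesis
        by (auto simp: W_def)
    qed
  qed
qed

lemma compactin_imp_ideal_compactin:
  assumes I: "ideal_on_nat I" and B: "shrinking_condition_B I"
    and X: "first_countable X" and S: "compactin X S"
  shows "ideal_compactin I X S"
  unfolding ideal_compactin_iff
proof (intro conjI allI impI)
  show "S \<subseteq> topspace X"
    using S by (rule compactin_subset_topspace)
  fix K x assume K: "K \<notin> I \<and> x \<in> K \<rightarrow> S"
  obtain l where l: "l \<in> S" "\<And>U. openin X U \<Longrightarrow> l \<in> U \<Longrightarrow> {n \<in> K. x n \<in> U} \<notin> I"
    using compactin_ideal_cluster_point[OF I S, of K x] K by auto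
  have lX: "l \<in> topspace X"
    using l(1) compactin_subset_topspace[OF S] by blast
  obtain W :: "nat \<Rightarrow> _" where W: "decseq W" "\<And>i. openin X (W i)" "\<And>i. l \<in> W i"
    "\<And>U. openin X U \<Longrightarrow> l \<in> U \<Longrightarrow> \<exists>i. W i \<subseteq> U"
    by (rule first_countable_decreasing_base[OF X lX]) (rule that; assumption)
  \<comment> \<open>These sets of visiting times are the input to condition (B). The union of the
    small pieces \<open>C i\<close> it returns becomes the index set of the subsequence.\<close>
  have "\<forall>i. {n \<in> K. x n \<in> W i} \<notin> I"
    using l(2) W(2,3) by blast
  then have "\<exists>C. (\<forall>i. C i \<in> I \<and> C i \<subseteq> {n \<in> K. x n \<in> W i}) \<and> (\<Union>i. C i) \<notin> I"
    by (rule B[unfolded shrinking_condition_B_def, THEN spec, THEN mp])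
  then obtain C where C: "\<And>i. C i \<in> I" "\<And>i. C i \<subseteq> {n \<in> K. x n \<in> W i}" "(\<Union>i. C i) \<notin> I"
    by metis
  have "trace_converges I X (\<Union>i. C i) x l"
    unfolding trace_converges_iff[OF I]
  proof (intro conjI allI impI)
    fix U assume U: "openin X U \<and> l \<in> U"
    then obtain i where i: "W i \<subseteq> U"
      using W(4) by blast
    \<comment> \<open>From \<open>i\<close> on, the pieces send \<open>x\<close> into
      \<open>W j \<subseteq> W i \<subseteq> U\<close>. Only the finitely many earlier pieces can
      contain exceptions, and each of them is in \<open>I\<close>.\<close>
    have "x n \<in> U" if "n \<in> C j" "i \<le> j" for n j
      using that C(2) i decseqD[OF W(1)] by blast
    then have "{n \<in> \<Union>i. C i. x n \<notin> U} \<subseteq> (\<Union>j<i. C j)"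
      by (fastforce simp: not_less[symmetric])
    moreover have "(\<Union>j<i. C j) \<in> I"
      using C(1) by (intro ideal_finite_Union[OF I]) auto
    ultimately show "{n \<in> \<Union>i. C i. x n \<notin> U} \<in> I"
      using ideal_subset[OF I] by blast
  qed (rule lX)
  then show "\<exists>M l. M \<subseteq> K \<and> M \<notin> I \<and> l \<in> S \<and> trace_converges I X M x l"
    using C(2,3) l(1) by blast
qed

lemma ideal_compactin_limit_point:
  assumes I: "admissible_ideal I" and S: "ideal_compactin I X S" and T: "T \<subseteq> S" "infinite T"
  shows "S \<inter> X derived_set_of T \<noteq> {}"
proof -
  note I' = admissible_idealD[OF I]
  obtain x :: "nat \<Rightarrow> 'a" where x: "inj x" "range x \<subseteq> T"
    using infinite_countable_subset[OF T(2)] by blast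
  \<comment> \<open>The sequence is indexed by all of \<open>UNIV\<close>, which is nonthin because
    \<open>I\<close> is nontrivial.\<close>
  then have "x \<in> UNIV \<rightarrow> S"
    using T(1) by auto
  then obtain M l where M: "M \<notin> I" "l \<in> S" "trace_converges I X M x l"
    using S I'(2) unfolding ideal_compactin_iff by meson
  have "\<exists>y\<in>T. y \<noteq> l \<and> y \<in> U" if U: "openin X U" "l \<in> U" for U
  proof -
    have "{n \<in> M. x n \<notin> U} \<in> I"
      using M(3) U unfolding trace_converges_iff[OF I'(1)] by blast
    moreover have "M = {n \<in> M. x n \<notin> U} \<union> {n \<in> M. x n \<in> U}"
      by blast
    \<comment> \<open>By admissibility finite sets lie in \<open>I\<close>, so a set outside
      \<open>I\<close> is infinite. Injectivity allows at most one of these indices to hit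
      \<open>l\<close> itself.\<close>
    ultimately have "infinite {n \<in> M. x n \<in> U}"
      using M(1) ideal_Un[OF I'(1)] admissible_ideal_finite[OF I] by metis
    moreover have "finite (x -` {l})"
      using x(1) by (intro finite_vimageI) auto
    ultimately obtain n where "x n \<in> U" "x n \<noteq> l"
      using finite_subset[of "{n \<in> M. x n \<in> U}" "x -` {l}"] by blast
    then show ?thesis
      using x(2) by blast
  qed
  then have "l \<in> X derived_set_of T"
    using M(3) unfolding in_derived_set_of trace_converges_def by blast
  then show ?thesis
    using M(2) by blast
qed

text \<open>Metrizability enters here: in a metric space the Bolzano-Weierstrass property
  characterizes compactness.\<close>

lemma ideal_compactin_imp_compactin:
  assumes "admissible_ideal I" "metrizable_space X" "ideal_compactin I X S"
  shows "compactin X S"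
proof -
  obtain M d where "Metric_space M d" and X: "X = Metric_space.mtopology M d"
    using assms(2) metrizable_space_def by blast
  then interpret Metric_space M d
    by simp
  show ?thesis
    using assms(3) ideal_compactin_limit_point[OF assms(1,3)]
    unfolding X compactin_eq_Bolzano_Weierstrass by (simp add: ideal_compactin_def)
qed

text \<open>\<open>Some\<close> embeds \<open>X\<close> as a subspace, and metrizability passes to
  subspaces and across homeomorphisms.\<close>

lemma metrizable_space_Alexandroff_compactificationD:
  assumes "metrizable_space (Alexandroff_compactification X)"
  shows "metrizable_space X"
  using embedding_map_imp_homeomorphic_space[OF embedding_map_Some]
    homeomorphic_metrizable_space metrizable_space_subtopology[OF assms] by blast

theorem theorem2p31:
  fixes I :: "nat set set" and X :: "'a topology"
  assumes "admissible_ideal I"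
    and "shrinking_condition_B I"
    and "metrizable_space (Alexandroff_compactification X)"
  shows "ideal_compactification I X homeomorphic_space Alexandroff_compactification X"
proof -
  have I: "ideal_on_nat I"
    using assms(1) by (rule admissible_idealD)
  have X: "metrizable_space X"
    using assms(3) by (rule metrizable_space_Alexandroff_compactificationD)
  have compact: "ideal_compactin I X S \<longleftrightarrow> compactin X S" for S
    using compactin_imp_ideal_compactin[OF I assms(2) metrizable_imp_first_countable[OF X]]
      ideal_compactin_imp_compactin[OF assms(1) X] by blast
  have "openin (ideal_compactification I X) W \<longleftrightarrow> openin (Alexandroff_compactification X) W" for W
  proof -
    \<comment> \<open>Neighbourhoods of infinity are described by \<open>U\<close> on one side and
      by its complement \<open>C\<close> on the other. Complementation within
      \<open>topspace X\<close> matches the two.\<close>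
    have "(\<exists>U. U \<subseteq> topspace X \<and> closedin X (topspace X - U) \<and>
          compactin X (topspace X - U) \<and> W = insert None (Some ` U)) \<longleftrightarrow>
        (\<exists>C. compactin X C \<and> closedin X C \<and> W = insert None (Some ` (topspace X - C)))"
      by (metis Diff_Diff_Int Diff_subset closedin_subset inf.absorb_iff2)
    then show ?thesis
      by (simp add: openin_ideal_compactification[OF I] ideal_compactification_open_def
          openin_Alexandroff_compactification compact)
  qed
  \<comment> \<open>Both topologies use \<open>None\<close> as the point at infinity, so they are
    equal and the identity is the homeomorphism.\<close>
  then have "ideal_compactification I X = Alexandroff_compactification X"
    by (simp add: topology_eq)
  then show ?thesis
    by simp
qed

end
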